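(* For each integer $n\ge 2$, the sum of the coefficients of $P_n(z)$ is equal to $n2^{\nu(n-2)-1}$, where $\nu(m)$ is the number of $1$s in the binary representation of $m$.
   Context: For an integer $s\ge 0$, let $S_s(z)=\prod_{i=1}^{s}(1+z^i)$, with $S_0(z)=1$. For an integer $n\ge 2$ let $$ W_n(z) = 2\sum_{i=1}^{\left\lfloor\frac{n-1}{2}\right\rfloor} S_{n-i-2}(z)\,S_{i-1}(z)\,z^{n-i-1} + \left(S_{\left\lfloor\frac{n-2}{2}\right\rfloor}(z)\right)^2 \quad\text{and}\quad D_n(z)=\prod_{j\ge 1} S_{\left\lfloor\frac{n-2}{2^j}\right\rfloor}(z). $$ $P_n(z)$ denotes the quotient $W_n(z)/D_n(z)$, i.e. the polynomial such that $W_n(z)=P_n(z)D_n(z)$. By convention $\nu(0)=0$. *)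

theory Defs
  imports Complex_Main "HOL-Computational_Algebra.Polynomial"
begin

definition S_poly :: "nat \<Rightarrow> int poly" where
  "S_poly s = (\<Prod>i = 1..s. 1 + monom 1 i)"

(* For n >= 2 and 1 <= i <= (n - 1) div 2 one has i + 2 <= n, so none of the
   subtractions on nat truncates. *)
definition W_poly :: "nat \<Rightarrow> int poly" where
  "W_poly n =
     2 * (\<Sum>i = 1..(n - 1) div 2. S_poly (n - i - 2) * S_poly (i - 1) * monom 1 (n - i - 1))
     + (S_poly ((n - 2) div 2))\<^sup>2"

(* The product over all j >= 1; it is cut off at j = n because the later factors
   are all 1, see S_poly_tail. *)
definition D_poly :: "nat \<Rightarrow> int poly" where
  "D_poly n = (\<Prod>j = 1..n. S_poly ((n - 2) div 2 ^ j))"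

lemma S_poly_tail:
  assumes "n < j"
  shows "S_poly ((n - 2) div 2 ^ j) = 1"
proof -
  have "j < 2 ^ j" by (rule less_exp)
  with assms have "n - 2 < 2 ^ j" by linarith
  then show ?thesis by (simp add: S_poly_def)
qed

(* D_poly n is monic, so it is immaterial whether the quotient is sought over the
   integers or over a larger coefficient ring such as the rationals. *)
definition P_poly :: "nat \<Rightarrow> int poly" where
  "P_poly n = (THE P. W_poly n = P * D_poly n)"

definition binary_ones :: "nat \<Rightarrow> nat" where
  "binary_ones m = card {k. bit m k}"

end

theory Submission
  imports Defs "HOL-Computational_Algebra.Fundamental_Theorem_Algebra"
begin

text \<open>
  Every summand of \<open>W\<^sub>n\<close> is a multiple of some \<open>S\<^sub>a S\<^sub>b\<close> with \<open>a + b + 1 \<ge> n - 2\<close>, and each such product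
  is already divisible by \<open>D\<^sub>n\<close>. To see this, compare orders of vanishing at a complex number \<open>z\<close>
  for which some power, say \<open>z\<^sup>m\<close> with \<open>m\<close> minimal, equals \<open>-1\<close>: the order of \<open>S\<^sub>s\<close> at \<open>z\<close> is
  \<open>\<lfloor>(s + m) / 2m\<rfloor> = \<lfloor>s / m\<rfloor> - \<lfloor>s / 2m\<rfloor>\<close>, so that the order of \<open>D\<^sub>n\<close> telescopes to
  \<open>\<lfloor>(n - 2) / 2m\<rfloor>\<close>, which is at most \<open>\<lfloor>(a + m) / 2m\<rfloor> + \<lfloor>(b + m) / 2m\<rfloor>\<close>.
  Evaluating \<open>W\<^sub>n = P\<^sub>n D\<^sub>n\<close> at \<open>1\<close> then gives the claim by Legendre's formula.
\<close>

subsection \<open>Divisibility of polynomials\<close>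

lemma map_poly_of_int_add:
  "map_poly of_int (p + q) = map_poly of_int p + (map_poly of_int q :: 'a::ring_1 poly)"
  by (rule poly_eqI) (simp add: coeff_map_poly)

lemma map_poly_of_int_mult:
  "map_poly of_int (p * q) = map_poly of_int p * (map_poly of_int q :: 'a::comm_ring_1 poly)"
  by (rule poly_eqI) (simp add: coeff_map_poly coeff_mult)

lemma map_poly_of_int_prod:
  "map_poly of_int (prod f A) = (\<Prod>x\<in>A. map_poly of_int (f x) :: 'a::comm_ring_1 poly)"
  by (induction A rule: infinite_finite_induct) (simp_all add: map_poly_of_int_mult)

text \<open>Pseudo-division by a monic polynomial is genuine division over the integers. A nonzero
  remainder would have degree below that of \<open>p\<close> and yet be a multiple of
  \<open>p\<close> over the larger ring.\<close>

lemma monic_dvd_of_int_polyD: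
  fixes p q :: "int poly"
  assumes "lead_coeff p = 1"
    and "map_poly of_int p dvd (map_poly of_int q :: 'a::{idom,ring_char_0} poly)"
  shows "p dvd q"
proof -
  have deg: "degree (map_poly of_int f :: 'a poly) = degree f" for f :: "int poly"
    by (rule degree_map_poly) simp
  have "p \<noteq> 0" using assms(1) by auto
  obtain c r where "pseudo_divmod q p = (c, r)" by fastforce
  from pseudo_divmod[OF \<open>p \<noteq> 0\<close> this]
  have q: "q = p * c + r" and r: "r = 0 \<or> degree r < degree p"
    using assms(1) by simp_all
  have "map_poly of_int p dvd (map_poly of_int r :: 'a poly)"
    using assms(2) unfolding q map_poly_of_int_add map_poly_of_int_mult
    by (subst (asm) dvd_add_right_iff) simp_all
  then have "map_poly of_int r = (0 :: 'a poly)"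
    using r dvd_imp_degree_le[of "map_poly of_int p :: 'a poly" "map_poly of_int r"]
    by (cases "map_poly of_int r = (0 :: 'a poly)") (auto simp: deg)
  then have "r = 0"
    by (simp add: map_poly_eq_0_iff)
  then show ?thesis using q by simp
qed

text \<open>Complex polynomials split into linear factors, so inclusion of the root multisets gives
  divisibility.\<close>

lemma complex_poly_dvdI_order:
  fixes p q :: "complex poly"
  assumes "p \<noteq> 0" "q \<noteq> 0" and "\<And>z. order z p \<le> order z q"
  shows "p dvd q"
proof -
  let ?f = "\<lambda>p. \<Prod>x\<in>#proots p. [:-x, 1:]"
  have "proots p \<subseteq># proots q"
    using assms by (intro mset_subset_eqI) simp
  then have "?f p dvd ?f q"
    by (intro prod_mset_subset_imp_dvd image_mset_subseteq_mono)
  then have "smult (lead_coeff p) (?f p) dvd smult (lead_coeff q) (?f q)"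
    using assms(1,2) by (simp add: smult_dvd_iff dvd_smult)
  then show ?thesis by (simp only: complex_poly_decompose_multiset)
qed

lemma order_prod:
  fixes f :: "'b \<Rightarrow> 'a::idom poly"
  assumes "finite A" "\<And>x. x \<in> A \<Longrightarrow> f x \<noteq> 0"
  shows "order z (prod f A) = (\<Sum>x\<in>A. order z (f x))"
  using assms by (induction A rule: finite_induct) (simp_all add: order_mult)

subsection \<open>Orders of vanishing\<close>

lemma degree_one_plus_monom: "degree (1 + monom 1 i :: 'a::{comm_ring_1,ring_char_0} poly) = i"
proof (cases "i = 0")
  case True
  then show ?thesis by (metis degree_of_nat monom_0 of_nat_1 of_nat_add one_pCons)
next
  case False
  then show ?thesis by (simp add: degree_add_eq_right degree_monom_eq)
qed

lemma one_plus_monom_nonzero: "1 + monom 1 i \<noteq> (0 :: 'a::{comm_ring_1,ring_char_0} poly)"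
proof
  assume "1 + monom 1 i = (0 :: 'a poly)"
  then have "poly (1 + monom 1 i) 1 = (0 :: 'a)" by (simp only: poly_0)
  then show False by (simp add: poly_monom)
qed

text \<open>Every root is simple: a common root with the derivative \<open>i * z ^ (i - 1)\<close>
  would have to be 0, which is not a root.\<close>

lemma order_one_plus_monom:
  fixes z :: "'a::field_char_0"
  assumes "i \<ge> 1"
  shows "order z (1 + monom 1 i) = (if z ^ i = -1 then 1 else 0)"
proof -
  let ?p = "1 + monom 1 i :: 'a poly"
  have root: "poly ?p z = 0 \<longleftrightarrow> z ^ i = -1"
    by (simp add: poly_monom add_eq_0_iff)
  have "rsquarefree ?p"
    unfolding rsquarefree_roots
    using assms by (auto simp: poly_monom pderiv_add pderiv_monom power_0_left)
  then show ?thesis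
    using root rsquarefree_root_order[of ?p z] order_0I[of ?p z]
    by (auto simp: one_plus_monom_nonzero)
qed

abbreviation S_complex :: "nat \<Rightarrow> complex poly" where
  "S_complex s \<equiv> map_poly of_int (S_poly s)"

lemma S_complex_eq: "S_complex s = (\<Prod>i = 1..s. 1 + monom 1 i)"
  by (simp add: S_poly_def map_poly_of_int_prod map_poly_of_int_add map_poly_monom)

lemma S_complex_nonzero: "S_complex s \<noteq> 0"
  unfolding S_complex_eq by (simp add: one_plus_monom_nonzero)

lemma lead_coeff_S_poly: "lead_coeff (S_poly s) = 1"
proof -
  have "lead_coeff (1 + monom 1 i :: int poly) = 1" if "i \<ge> 1" for i
    using that unfolding degree_one_plus_monom by simp
  then show ?thesis
    unfolding S_poly_def lead_coeff_prod by (intro prod.neutral) auto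
qed

lemma order_S_complex: "order z (S_complex s) = card {i \<in> {1..s}. z ^ i = -1}"
proof -
  have "order z (S_complex s) = (\<Sum>i = 1..s. order z (1 + monom 1 i))"
    unfolding S_complex_eq by (rule order_prod) (simp_all add: one_plus_monom_nonzero)
  also have "\<dots> = (\<Sum>i = 1..s. if z ^ i = -1 then 1 else 0)"
    by (intro sum.cong) (simp_all add: order_one_plus_monom)
  finally show ?thesis by (simp add: sum.inter_filter[symmetric])
qed

text \<open>Such \<open>z\<close> are the primitive \<open>2 * m\<close>-th roots of unity, and
  every root of any \<open>S_poly s\<close> is of this kind for some \<open>m\<close>.\<close>

locale minimal_root_of_minus_one =
  fixes z :: complex and m :: nat
  assumes m_pos: "m > 0" and z_m: "z ^ m = -1"
    and minimal: "0 < j \<Longrightarrow> j < m \<Longrightarrow> z ^ j \<noteq> -1"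
begin

text \<open>Since \<open>z ^ i = - (z ^ (i + m))\<close>, this says that \<open>z\<close> has
  multiplicative order exactly \<open>2 * m\<close>.\<close>

lemma power_eq_minus_one_iff: "z ^ i = -1 \<longleftrightarrow> 2 * m dvd i + m"
proof -
  define r where "r = (i + m) mod (2 * m)"
  have "z ^ (2 * m) = 1"
    by (simp add: mult_2 power_add z_m)
  have "z ^ (i + m) = z ^ (2 * m * ((i + m) div (2 * m)) + r)"
    by (simp only: r_def mult_div_mod_eq)
  also have "\<dots> = z ^ r"
    by (simp only: power_add power_mult[of z "2 * m"] \<open>z ^ (2 * m) = 1\<close>) simp
  finally have zr: "z ^ i = - (z ^ r)"
    by (simp add: power_add z_m minus_equation_iff eq_commute)
  have "z ^ r \<noteq> 1" if "r > 0"
  proof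
    assume "z ^ r = 1"
    have "r < 2 * m" using m_pos by (simp add: r_def)
    consider "r < m" | "r = m" | "r > m" by linarith
    then show False
    proof cases
      case 1
      then have "z ^ m = z ^ r * z ^ (m - r)" by (simp flip: power_add)
      with \<open>z ^ r = 1\<close> z_m minimal[of "m - r"] 1 that show False by simp
    next
      case 2
      with \<open>z ^ r = 1\<close> z_m show False by simp
    next
      case 3
      then have "z ^ r = z ^ m * z ^ (r - m)" by (simp flip: power_add)
      with \<open>z ^ r = 1\<close> z_m have "z ^ (r - m) = -1" by (simp add: minus_equation_iff)
      moreover have "0 < r - m" "r - m < m" using 3 \<open>r < 2 * m\<close> by linarith+
      ultimately show False using minimal by blast
    qed
  qed
  then have "z ^ i = -1 \<longleftrightarrow> r = 0" by (auto simp: zr)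
  then show ?thesis by (simp add: r_def dvd_eq_mod_eq_0)
qed

text \<open>Adding \<open>m\<close> turns the exponents to be counted into the multiples of
  \<open>2 * m\<close> in \<open>{m + 1..s + m}\<close>; no positive multiple is smaller.\<close>

lemma order_S: "order z (S_complex s) = (s + m) div (2 * m)"
proof -
  have "card {i \<in> {1..s}. 2 * m dvd i + m} = (s + m) div (2 * m)"
  proof (induction s)
    case 0
    then show ?case using m_pos by simp
  next
    case (Suc s)
    have "{i \<in> {1..Suc s}. 2 * m dvd i + m} = {i \<in> {1..s}. 2 * m dvd i + m} \<union>
        (if 2 * m dvd Suc s + m then {Suc s} else {})"
      by (auto simp: le_Suc_eq)
    then have "card {i \<in> {1..Suc s}. 2 * m dvd i + m} = card {i \<in> {1..s}. 2 * m dvd i + m} +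
        (if 2 * m dvd Suc s + m then 1 else 0)"
      by simp
    then show ?case using Suc.IH by (simp add: div_Suc dvd_eq_mod_eq_0)
  qed
  then show ?thesis by (simp add: order_S_complex power_eq_minus_one_iff)
qed

text \<open>With \<open>x = s div m\<close> this is
  \<open>(x + 1) div 2 + x div 2 = x\<close>.\<close>

lemma order_S_telescope: "order z (S_complex s) + s div (2 * m) = s div m"
proof -
  have "s div (2 * m) = s div m div 2"
    by (metis div_mult2_eq mult.commute)
  moreover have "(s + m) div (2 * m) = (s div m + 1) div 2"
    using m_pos by (metis div_mult2_eq mult.commute div_add_self2 not_gr_zero)
  ultimately show ?thesis by (simp add: order_S)
qed

text \<open>The leftover term keeps the telescoping exact for every \<open>k\<close>; dropping it
  bounds the order of \<open>D_poly\<close>.\<close>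

lemma sum_order_S:
  "(\<Sum>j = 1..k. order z (S_complex (s div 2 ^ j))) + s div 2 ^ k div (2 * m) = s div (2 * m)"
proof (induction k)
  case (Suc k)
  have "s div 2 ^ k div (2 * m) = s div 2 ^ Suc k div m"
    by (simp flip: div_mult2_eq add: ac_simps)
  then show ?case
    using Suc.IH order_S_telescope[of "s div 2 ^ Suc k"] by simp
qed simp

text \<open>The two shifts by \<open>m\<close> make up one full period \<open>2 * m\<close>;
  strictness of both bounds accounts for the extra 1.\<close>

lemma order_S_superadditive:
  assumes "s \<le> a + b + 1"
  shows "s div (2 * m) \<le> order z (S_complex a) + order z (S_complex b)"
proof -
  define u v where "u = (a + m) div (2 * m)" and "v = (b + m) div (2 * m)"
  have "a + m < (u + 1) * (2 * m)" "b + m < (v + 1) * (2 * m)"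
    using m_pos dividend_less_div_times[of "2 * m" "a + m"] dividend_less_div_times[of "2 * m" "b + m"]
    by (simp_all add: u_def v_def algebra_simps)
  with assms have "s < (u + v + 1) * (2 * m)" by (simp add: algebra_simps)
  then have "s div (2 * m) < u + v + 1" by (rule less_mult_imp_div_less)
  then show ?thesis by (simp add: order_S u_def v_def)
qed

end

lemma order_D_le:
  assumes "n - 2 \<le> a + b + 1"
  shows "order z (map_poly of_int (D_poly n)) \<le> order z (S_complex a) + order z (S_complex b)"
proof -
  have D: "order z (map_poly of_int (D_poly n))
      = (\<Sum>j = 1..n. order z (S_complex ((n - 2) div 2 ^ j)))"
    unfolding D_poly_def map_poly_of_int_prod
    by (rule order_prod) (simp_all add: S_complex_nonzero)
  show ?thesis
  proof (cases "\<exists>m>0. z ^ m = -1")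
    case True
    define m where "m = (LEAST m. m > 0 \<and> z ^ m = -1)"
    have "m > 0 \<and> z ^ m = -1"
      unfolding m_def by (rule LeastI_ex) (use True in blast)
    moreover have "z ^ j \<noteq> -1" if "0 < j" "j < m" for j
      using not_less_Least[of j "\<lambda>m. m > 0 \<and> z ^ m = -1"] that by (auto simp: m_def)
    ultimately interpret minimal_root_of_minus_one z m
      by unfold_locales auto
    show ?thesis
      using sum_order_S[where k = n and s = "n - 2"] order_S_superadditive[OF assms]
      by (simp add: D)
  next
    case False
    then have "z ^ i \<noteq> -1" if "i \<in> {1..s}" for i s :: nat
      using that by (metis atLeastAtMost_iff less_le_trans zero_less_one)
    then have "{i \<in> {1..s}. z ^ i = -1} = {}" for s
      by blast
    then have "order z (S_complex s) = 0" for s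
      by (simp only: order_S_complex card.empty)
    then show ?thesis by (simp add: D)
  qed
qed

subsection \<open>The quotient\<close>

lemma lead_coeff_D_poly: "lead_coeff (D_poly n) = 1"
  unfolding D_poly_def lead_coeff_prod by (simp add: lead_coeff_S_poly)

lemma D_poly_nonzero: "D_poly n \<noteq> 0"
  using lead_coeff_D_poly[of n] by auto

lemma D_poly_dvd_S_poly_mult:
  assumes "n - 2 \<le> a + b + 1"
  shows "D_poly n dvd S_poly a * S_poly b"
proof -
  have "map_poly of_int (D_poly n) dvd S_complex a * S_complex b"
  proof (rule complex_poly_dvdI_order)
    show "map_poly of_int (D_poly n) \<noteq> (0 :: complex poly)"
      by (simp add: map_poly_eq_0_iff D_poly_nonzero)
    show nz: "S_complex a * S_complex b \<noteq> 0"
      by (simp add: S_complex_nonzero)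
    show "order z (map_poly of_int (D_poly n)) \<le> order z (S_complex a * S_complex b)" for z
      using order_D_le[OF assms] by (simp add: order_mult[OF nz])
  qed
  then show ?thesis
    by (intro monic_dvd_of_int_polyD[where 'a = complex])
      (simp_all add: lead_coeff_D_poly map_poly_of_int_mult)
qed

lemma D_poly_dvd_W_poly: "D_poly n dvd W_poly n"
proof -
  have "D_poly n dvd S_poly (n - i - 2) * S_poly (i - 1) * monom 1 (n - i - 1)" for i
    \<comment> \<open>In the range of summation the two indices add up to \<open>n - 3\<close>, so
      the bound is attained; elsewhere truncation only enlarges their sum.\<close>
    by (rule dvd_mult2, rule D_poly_dvd_S_poly_mult) linarith
  moreover have "D_poly n dvd S_poly ((n - 2) div 2) * S_poly ((n - 2) div 2)"
    by (rule D_poly_dvd_S_poly_mult) linarith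
  ultimately show ?thesis
    unfolding W_poly_def power2_eq_square by (intro dvd_add dvd_mult[OF dvd_sum])
qed

text \<open>Cancelling the nonzero \<open>D_poly n\<close> gives the uniqueness that
  \<open>THE\<close> requires.\<close>

lemma P_poly_mult_D_poly: "P_poly n * D_poly n = W_poly n"
proof -
  obtain Q where Q: "W_poly n = D_poly n * Q"
    using D_poly_dvd_W_poly by (rule dvdE)
  have "\<exists>!P. W_poly n = P * D_poly n"
  proof (rule ex1I)
    show "W_poly n = Q * D_poly n"
      by (simp only: Q mult.commute)
    show "P = Q" if "W_poly n = P * D_poly n" for P
      using that D_poly_nonzero[of n] unfolding Q
      by (simp add: mult.commute[of P])
  qed
  from theI'[OF this] show ?thesis by (simp add: P_poly_def)
qed

subsection \<open>Values at 1\<close>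

lemma poly_S_poly_1: "poly (S_poly s) 1 = 2 ^ s"
  by (simp add: S_poly_def poly_prod poly_monom)

lemma poly_W_poly_1:
  assumes "n \<ge> 2"
  shows "2 * poly (W_poly n) 1 = int n * 2 ^ (n - 2)"
proof -
  define K where "K = (n - 1) div 2"
  \<comment> \<open>For \<open>n = 2\<close> the exponent \<open>n - 3\<close> truncates, but then
    \<open>K = 0\<close> and the sum is empty.\<close>
  have "(\<Sum>i = 1..K. 2 ^ (n - i - 2) * 2 ^ (i - 1)) = (\<Sum>i = 1..K. 2 ^ (n - 3) :: int)"
    by (intro sum.cong) (auto simp: K_def simp flip: power_add)
  then have W: "poly (W_poly n) 1 = 2 * (int K * 2 ^ (n - 3)) + 2 ^ (2 * ((n - 2) div 2))"
    by (simp add: W_poly_def K_def poly_sum poly_monom poly_S_poly_1 power_mult[symmetric] ac_simps)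
  show ?thesis
  proof (cases "even n")
    case True
    then obtain t where "n = 2 * t" by blast
    with assms obtain u where n: "n = 2 * u + 2" by (cases t) auto
    then have "K = u" by (simp add: K_def)
    then show ?thesis
      using W n by (cases u) (simp_all add: algebra_simps)
  next
    case False
    then obtain t where "n = 2 * t + 1" by (rule oddE)
    with assms obtain u where n: "n = 2 * u + 3" by (cases t) auto
    then have "K = u + 1" by (simp add: K_def)
    then show ?thesis
      using W n by (simp add: algebra_simps)
  qed
qed

section \<open>Binary digit sums and Legendre's formula for the prime 2\<close>

lemma finite_bits_nat: "finite {k. bit (m::nat) k}"
proof (rule finite_subset)
  show "{k. bit m k} \<subseteq> {..<m}"
  proof
    fix k
    assume "k \<in> {k. bit m k}"
    then have "m div 2 ^ k \<noteq> 0" by (auto simp: bit_iff_odd intro!: Nat.gr0I)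
    then have "2 ^ k \<le> m" by (simp add: div_eq_0_iff)
    with less_exp[of k] show "k \<in> {..<m}" by (simp only: lessThan_iff)
  qed
qed simp

lemma binary_ones_rec: "binary_ones m = m mod 2 + binary_ones (m div 2)"
proof -
  have "bit m k \<longleftrightarrow> k = 0 \<and> odd m \<or> (\<exists>l. k = Suc l \<and> bit (m div 2) l)" for k
    by (cases k) (auto simp: bit_0 bit_Suc)
  then have "{k. bit m k} = (if odd m then {0} else {}) \<union> Suc ` {k. bit (m div 2) k}"
    by auto
  then show ?thesis
    by (simp add: binary_ones_def card_insert_if card_image finite_bits_nat odd_iff_mod_2_eq_one)
qed

text \<open>The sum is the exponent of 2 in the factorial of \<open>s\<close>. Halving
  \<open>s\<close> shifts the sum by one place and removes the last binary digit.\<close>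

lemma legendre_binary_ones:
  assumes "s < 2 ^ k"
  shows "(\<Sum>j = 1..k. s div 2 ^ j) + binary_ones s = s"
  using assms
proof (induction k arbitrary: s)
  case 0
  then show ?case by (simp add: binary_ones_def)
next
  case (Suc k)
  have "(\<Sum>j = 1..Suc k. s div 2 ^ j) = s div 2 + (\<Sum>j = 1..k. s div 2 div 2 ^ j)"
    by (simp add: sum.atLeast_Suc_atMost sum.shift_bounds_cl_Suc_ivl div_mult2_eq
        del: sum.cl_ivl_Suc)
  moreover have "(\<Sum>j = 1..k. s div 2 div 2 ^ j) + binary_ones (s div 2) = s div 2"
    using Suc by simp
  ultimately show ?case
    using binary_ones_rec[of s] by presburger
qed

lemma poly_D_poly_1: "poly (D_poly n) 1 * 2 ^ binary_ones (n - 2) = 2 ^ (n - 2)"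
proof -
  have "n - 2 < 2 ^ n" using less_exp[of n] by linarith
  from legendre_binary_ones[OF this] show ?thesis
    by (simp add: D_poly_def poly_prod poly_S_poly_1 flip: power_sum power_add)
qed

theorem theorem5:
  fixes n :: nat
  assumes "n \<ge> 2"
  shows "real_of_int (\<Sum>k\<le>degree (P_poly n). coeff (P_poly n) k)
           = real n * 2 powi (int (binary_ones (n - 2)) - 1)"
proof -
  let ?p = "poly (P_poly n) 1" and ?d = "poly (D_poly n) 1" and ?b = "binary_ones (n - 2)"
  have "(2 * ?p) * ?d = 2 * poly (W_poly n) 1"
    by (simp flip: P_poly_mult_D_poly)
  also have "\<dots> = int n * 2 ^ ?b * ?d"
    by (simp add: poly_W_poly_1[OF assms] flip: poly_D_poly_1)
  finally have "2 * ?p = int n * 2 ^ ?b"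
    using poly_D_poly_1[of n] by auto
  then have "2 * real_of_int ?p = real n * 2 ^ ?b"
    by (metis of_int_mult of_int_numeral of_int_of_nat_eq of_int_power)
  then have "real_of_int ?p = real n * (2 ^ ?b / 2)"
    by simp
  \<comment> \<open>The integer exponent is -1 when \<open>n = 2\<close>, as
    \<open>binary_ones 0 = 0\<close>.\<close>
  moreover have "(2 ^ ?b / 2 :: real) = 2 powi (int ?b - 1)"
    by (simp add: power_int_diff)
  moreover have "(\<Sum>k\<le>degree (P_poly n). coeff (P_poly n) k) = ?p"
    by (simp add: poly_altdef)
  ultimately show ?thesis by (simp only:)
qed

end
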